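(* Let $a,b,c,d$ be nonzero complex numbers. Consider an alternating bilinear product $[\cdot,\cdot]$ on $\mathbb{C}^{25}$ with basis $e_1,\dots,e_{25}$ of the form described in the context, normalised by requiring: the coefficient of $e_{16}$ in $[e_4,e_7]$ is $3a$, the coefficient of $e_{23}$ in $[e_4,e_{15}]$ is $60b$, the coefficient of $e_{23}$ in $[e_{11},e_{14}]$ is $2c$, and the coefficient of $e_{23}$ in $[e_4,e_{21}]$ is $15d$. Then the product satisfies the Jacobi identity, i.e. defines the Lie algebra $L(a,b,c,d)$, if and only if the brackets within and between $\mathfrak{g}_1,\mathfrak{g}_2,\mathfrak{g}_3,\mathfrak{g}_4$ are given (up to skew-symmetry, all unlisted brackets of basis vectors among these subspaces being zero) by the following list. $[\mathfrak{g}_1,\mathfrak{g}_1]$: $[e_4,e_7]=3ae_{16}$, $[e_4,e_8]=12ae_{17}$, $[e_4,e_9]=30ae_{18}$, $[e_4,e_{10}]=60ae_{19}$, $[e_5,e_6]=-2ae_{16}$, $[e_5,e_7]=-3ae_{17}$, $[e_5,e_9]=10ae_{19}$, $[e_5,e_{10}]=30ae_{20}$, $[e_6,e_7]=-3ae_{18}$, $[e_6,e_8]=-4ae_{19}$, $[e_6,e_{10}]=12ae_{21}$, $[e_7,e_8]=-3ae_{20}$, $[e_7,e_9]=-3ae_{21}$, $[e_7,e_{10}]=3ae_{22}$, $[e_8,e_9]=-2ae_{22}$. $[\mathfrak{g}_1,\mathfrak{g}_2]$: $[e_4,e_{15}]=60be_{23}$, $[e_5,e_{14}]=-10be_{23}$,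 $[e_5,e_{15}]=20be_{24}$, $[e_6,e_{13}]=4be_{23}$, $[e_6,e_{14}]=-8be_{24}$, $[e_6,e_{15}]=4be_{25}$, $[e_7,e_{12}]=-3be_{23}$, $[e_7,e_{13}]=6be_{24}$, $[e_7,e_{14}]=-3be_{25}$, $[e_8,e_{11}]=4be_{23}$, $[e_8,e_{12}]=-8be_{24}$, $[e_8,e_{13}]=4be_{25}$, $[e_9,e_{11}]=20be_{24}$, $[e_9,e_{12}]=-10be_{25}$, $[e_{10},e_{11}]=60be_{25}$. $[\mathfrak{g}_2,\mathfrak{g}_2]$: $[e_{11},e_{14}]=2ce_{23}$, $[e_{11},e_{15}]=8ce_{24}$, $[e_{12},e_{13}]=-ce_{23}$, $[e_{12},e_{14}]=-ce_{24}$, $[e_{12},e_{15}]=2ce_{25}$, $[e_{13},e_{14}]=-ce_{25}$. $[\mathfrak{g}_1,\mathfrak{g}_3]$: $[e_4,e_{21}]=15de_{23}$, $[e_4,e_{22}]=90de_{24}$, $[e_5,e_{20}]=-5de_{23}$, $[e_5,e_{21}]=-10de_{24}$, $[e_5,e_{22}]=15de_{25}$, $[e_6,e_{19}]=3de_{23}$, $[e_6,e_{20}]=2de_{24}$, $[e_6,e_{21}]=-5de_{25}$, $[e_7,e_{18}]=-3de_{23}$, $[e_7,e_{20}]=3de_{25}$, $[e_8,e_{17}]=5de_{23}$, $[e_8,e_{18}]=-2de_{24}$, $[e_8,e_{19}]=-3de_{25}$, $[e_9,e_{16}]=-15de_{23}$, $[e_9,e_{17}]=10de_{24}$, $[e_9,e_{18}]=5de_{25}$,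 $[e_{10},e_{16}]=-90de_{24}$, $[e_{10},e_{17}]=-15de_{25}$.
   Context: Put $\mathfrak{g}_1=\langle e_4,\dots,e_{10}\rangle$, $\mathfrak{g}_2=\langle e_{11},\dots,e_{15}\rangle$, $\mathfrak{g}_3=\langle e_{16},\dots,e_{22}\rangle$, $\mathfrak{g}_4=\langle e_{23},e_{24},e_{25}\rangle$. The alternating bilinear products considered are those of the following form. (1) $[e_1,e_2]=e_3$, $[e_1,e_3]=-2e_1$, $[e_2,e_3]=2e_2$ (so $\langle e_1,e_2,e_3\rangle\cong\mathfrak{sl}_2(\mathbb{C})$). (2) For each $\mathfrak{g}_j$, writing its listed basis in order as $f_0,\dots,f_m$ (with $m=6,4,6,2$ for $j=1,2,3,4$) and $f_{-1}=f_{m+1}=0$: $[e_1,f_i]=i f_{i-1}$, $[e_2,f_i]=(m-i)f_{i+1}$, $[e_3,f_i]=(m-2i)f_i$ (so each $\mathfrak{g}_j$ is the irreducible $\mathfrak{sl}_2(\mathbb{C})$-module of dimension $m+1$). (3) $[\mathfrak{g}_1,\mathfrak{g}_1]\subseteq\mathfrak{g}_3$, $[\mathfrak{g}_1,\mathfrak{g}_2]\subseteq\mathfrak{g}_4$, $[\mathfrak{g}_2,\mathfrak{g}_2]\subseteq\mathfrak{g}_4$, $[\mathfrak{g}_1,\mathfrak{g}_3]\subseteq\mathfrak{g}_4$, with otherwise arbitrary complex structure constants, and all other brackets $[\mathfrak{g}_i,\mathfrak{g}_j]$ with $1\le i\le j\le 4$ are zero. $L(a,b,c,d)$ is the name of the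 Lie algebra of this form with the stated normalisation. *)

theory Defs
  imports "HOL-Analysis.Analysis" "HOL-Library.Numeral_Type"
begin

text \<open>
  The basis vectors \<open>evec 1, \<dots>, evec 25\<close> of \<open>complex ^ 25\<close>. The index type \<open>25\<close> consists of the
  residues modulo 25, so \<open>evec 25\<close> is the unit vector at index \<open>0\<close>; on \<open>{1..25}\<close> the map
  \<open>of_nat\<close> is a bijection onto the index type.
\<close>

definition evec :: "nat \<Rightarrow> complex ^ 25" where
  "evec k = axis (of_nat k) 1"

definition coord :: "nat \<Rightarrow> complex ^ 25 \<Rightarrow> complex" where
  "coord k v = v $ of_nat k"

text \<open>
  HOL-Analysis's \<open>bilinear\<close> is linearity over the reals, hence the explicit complex linearity.
\<close>

definition alternating_bilinear ::
    "(complex ^ 25 \<Rightarrow> complex ^ 25 \<Rightarrow> complex ^ 25) \<Rightarrow> bool" where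
  "alternating_bilinear br \<longleftrightarrow>
     (\<forall>x. Vector_Spaces.linear (*s) (*s) (\<lambda>y. br x y)) \<and>
     (\<forall>y. Vector_Spaces.linear (*s) (*s) (\<lambda>x. br x y)) \<and>
     (\<forall>x. br x x = 0)"

definition jacobi :: "(complex ^ 25 \<Rightarrow> complex ^ 25 \<Rightarrow> complex ^ 25) \<Rightarrow> bool" where
  "jacobi br \<longleftrightarrow> (\<forall>x y z. br x (br y z) + br y (br z x) + br z (br x y) = 0)"

text \<open>
  \<open>g_first j\<close> is the index of the first basis vector of \<open>\<gg>\<^sub>j\<close>, and \<open>g_top j\<close> is the
  number \<open>m\<close> with \<open>dim \<gg>\<^sub>j = m + 1\<close>; only \<open>j = 1, 2, 3, 4\<close> matters.
\<close>

definition g_first :: "nat \<Rightarrow> nat" where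
  "g_first j = (if j = 1 then 4 else if j = 2 then 11 else if j = 3 then 16 else 23)"

definition g_top :: "nat \<Rightarrow> nat" where
  "g_top j = (if j = 1 then 6 else if j = 2 then 4 else if j = 3 then 6 else 2)"

text \<open>
  The listed basis \<open>f\<^sub>0, \<dots>, f\<^sub>m\<close> of \<open>\<gg>\<^sub>j\<close>, with integer index so that
  \<open>f\<^bsub>-1\<^esub> = f\<^bsub>m+1\<^esub> = 0\<close> can be stated literally.
\<close>

definition fvec :: "nat \<Rightarrow> int \<Rightarrow> complex ^ 25" where
  "fvec j i = (if 0 \<le> i \<and> i \<le> int (g_top j) then evec (g_first j + nat i) else 0)"

definition gsub :: "nat \<Rightarrow> (complex ^ 25) set" where
  "gsub j = vec.span (fvec j ` {0..int (g_top j)})"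

definition sl2_relations :: "(complex ^ 25 \<Rightarrow> complex ^ 25 \<Rightarrow> complex ^ 25) \<Rightarrow> bool" where
  "sl2_relations br \<longleftrightarrow>
     br (evec 1) (evec 2) = evec 3 \<and>
     br (evec 1) (evec 3) = (-2) *s evec 1 \<and>
     br (evec 2) (evec 3) = 2 *s evec 2"

definition sl2_action :: "(complex ^ 25 \<Rightarrow> complex ^ 25 \<Rightarrow> complex ^ 25) \<Rightarrow> bool" where
  "sl2_action br \<longleftrightarrow>
     (\<forall>j\<in>{1..4}. \<forall>i\<in>{0..int (g_top j)}.
        br (evec 1) (fvec j i) = of_int i *s fvec j (i - 1) \<and>
        br (evec 2) (fvec j i) = of_int (int (g_top j) - i) *s fvec j (i + 1) \<and>
        br (evec 3) (fvec j i) = of_int (int (g_top j) - 2 * i) *s fvec j i)"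

definition nilradical_shape :: "(complex ^ 25 \<Rightarrow> complex ^ 25 \<Rightarrow> complex ^ 25) \<Rightarrow> bool" where
  "nilradical_shape br \<longleftrightarrow>
     (\<forall>x\<in>gsub 1. \<forall>y\<in>gsub 1. br x y \<in> gsub 3) \<and>
     (\<forall>x\<in>gsub 1. \<forall>y\<in>gsub 2. br x y \<in> gsub 4) \<and>
     (\<forall>x\<in>gsub 2. \<forall>y\<in>gsub 2. br x y \<in> gsub 4) \<and>
     (\<forall>x\<in>gsub 1. \<forall>y\<in>gsub 3. br x y \<in> gsub 4) \<and>
     (\<forall>i j. 1 \<le> i \<and> i \<le> j \<and> j \<le> 4 \<and> (i, j) \<notin> {(1, 1), (1, 2), (2, 2), (1, 3)} \<longrightarrow>
        (\<forall>x\<in>gsub i. \<forall>y\<in>gsub j. br x y = 0))"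

definition considered_product :: "(complex ^ 25 \<Rightarrow> complex ^ 25 \<Rightarrow> complex ^ 25) \<Rightarrow> bool" where
  "considered_product br \<longleftrightarrow>
     alternating_bilinear br \<and> sl2_relations br \<and> sl2_action br \<and> nilradical_shape br"

definition normalised ::
    "complex \<Rightarrow> complex \<Rightarrow> complex \<Rightarrow> complex \<Rightarrow>
     (complex ^ 25 \<Rightarrow> complex ^ 25 \<Rightarrow> complex ^ 25) \<Rightarrow> bool" where
  "normalised a b c d br \<longleftrightarrow>
     coord 16 (br (evec 4) (evec 7)) = 3 * a \<and>
     coord 23 (br (evec 4) (evec 15)) = 60 * b \<and>
     coord 23 (br (evec 11) (evec 14)) = 2 * c \<and>
     coord 23 (br (evec 4) (evec 21)) = 15 * d"

text \<open>An entry \<open>((i, j), (s, k))\<close>, always with \<open>i < j\<close>, stands for \<open>[e\<^sub>i, e\<^sub>j] = s e\<^sub>k\<close>.\<close>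

definition L_table ::
    "complex \<Rightarrow> complex \<Rightarrow> complex \<Rightarrow> complex \<Rightarrow> ((nat \<times> nat) \<times> (complex \<times> nat)) list" where
  "L_table a b c d =
   [((4, 7), (3 * a, 16)), ((4, 8), (12 * a, 17)), ((4, 9), (30 * a, 18)),
    ((4, 10), (60 * a, 19)), ((5, 6), (-2 * a, 16)), ((5, 7), (-3 * a, 17)),
    ((5, 9), (10 * a, 19)), ((5, 10), (30 * a, 20)), ((6, 7), (-3 * a, 18)),
    ((6, 8), (-4 * a, 19)), ((6, 10), (12 * a, 21)), ((7, 8), (-3 * a, 20)),
    ((7, 9), (-3 * a, 21)), ((7, 10), (3 * a, 22)), ((8, 9), (-2 * a, 22)),

    ((4, 15), (60 * b, 23)), ((5, 14), (-10 * b, 23)), ((5, 15), (20 * b, 24)),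
    ((6, 13), (4 * b, 23)), ((6, 14), (-8 * b, 24)), ((6, 15), (4 * b, 25)),
    ((7, 12), (-3 * b, 23)), ((7, 13), (6 * b, 24)), ((7, 14), (-3 * b, 25)),
    ((8, 11), (4 * b, 23)), ((8, 12), (-8 * b, 24)), ((8, 13), (4 * b, 25)),
    ((9, 11), (20 * b, 24)), ((9, 12), (-10 * b, 25)), ((10, 11), (60 * b, 25)),

    ((11, 14), (2 * c, 23)), ((11, 15), (8 * c, 24)), ((12, 13), (-c, 23)),
    ((12, 14), (-c, 24)), ((12, 15), (2 * c, 25)), ((13, 14), (-c, 25)),

    ((4, 21), (15 * d, 23)), ((4, 22), (90 * d, 24)), ((5, 20), (-5 * d, 23)),
    ((5, 21), (-10 * d, 24)), ((5, 22), (15 * d, 25)), ((6, 19), (3 * d, 23)),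
    ((6, 20), (2 * d, 24)), ((6, 21), (-5 * d, 25)), ((7, 18), (-3 * d, 23)),
    ((7, 20), (3 * d, 25)), ((8, 17), (5 * d, 23)), ((8, 18), (-2 * d, 24)),
    ((8, 19), (-3 * d, 25)), ((9, 16), (-15 * d, 23)), ((9, 17), (10 * d, 24)),
    ((9, 18), (5 * d, 25)), ((10, 16), (-90 * d, 24)), ((10, 17), (-15 * d, 25))]"

text \<open>
  Pairs absent from the table have bracket zero. The brackets with \<open>i \<ge> j\<close> are determined by
  these, since the products considered are alternating.
\<close>

definition brackets_as_listed ::
    "complex \<Rightarrow> complex \<Rightarrow> complex \<Rightarrow> complex \<Rightarrow>
     (complex ^ 25 \<Rightarrow> complex ^ 25 \<Rightarrow> complex ^ 25) \<Rightarrow> bool" where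
  "brackets_as_listed a b c d br \<longleftrightarrow>
     (\<forall>i j. 4 \<le> i \<and> i < j \<and> j \<le> 25 \<longrightarrow>
        br (evec i) (evec j) =
          (case map_of (L_table a b c d) (i, j) of None \<Rightarrow> 0 | Some (s, k) \<Rightarrow> s *s evec k))"

end

theory Submission
  imports Defs
begin

text \<open>
  Identify the irreducible module with top weight $m$ with the binary forms of degree $m$. The Jacobi
  identity for triples containing an element of \<open>sl\<^sub>2\<close> says that each of the four brackets
  is \<open>sl\<^sub>2\<close>-equivariant. Each of the target modules occurs exactly once in the
  respective tensor product (or exterior square), so the bracket is a multiple of a transvectant, of
  order 3, 4, 3 and 5 respectively, and the normalisation fixes the multiple: $a/240$, $b/144$, $c/72$,
  $d/5760$. Conversely these brackets are equivariant, and the only remaining instance of the Jacobi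
  identity that is not trivial for degree reasons is the one on three elements of \<open>\<gg>\<^sub>1\<close>. It asks
  an alternating map into \<open>\<gg>\<^sub>4\<close> to vanish, which is checked on weights.
\<close>

section \<open>Transvectant coefficients\<close>

text \<open>
  Applying the operator $\Omega = \partial_x \partial_{y'} - \partial_y \partial_{x'}$ exactly $s$
  times to the monomial $x^k y^i x'^l y'^j$ and then setting $x' = x$, $y' = y$ yields
  \<open>transvectant_coeff s k i l j\<close> times $x^{k+l-s} y^{i+j-s}$. Negative exponents are allowed, so
  that the equivariance identities below need no side conditions.
\<close>

primrec transvectant_coeff :: "nat \<Rightarrow> int \<Rightarrow> int \<Rightarrow> int \<Rightarrow> int \<Rightarrow> int" where
  "transvectant_coeff 0 k i l j = 1"
| "transvectant_coeff (Suc s) k i l j =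
     k * j * transvectant_coeff s (k - 1) i l (j - 1) -
     i * l * transvectant_coeff s k (i - 1) (l - 1) j"

lemma transvectant_coeff_numeral:
  "transvectant_coeff (numeral n) k i l j =
     k * j * transvectant_coeff (pred_numeral n) (k - 1) i l (j - 1) -
     i * l * transvectant_coeff (pred_numeral n) k (i - 1) (l - 1) j"
  by (simp add: numeral_eq_Suc)

text \<open>Omega commutes with x d/dy + x' d/dy', the operator by which e_1 acts on products of two
  forms. Applying both to a monomial, in either order, and comparing coefficients gives the
  identity.\<close>

lemma transvectant_coeff_lower:
  "i * transvectant_coeff s (k + 1) (i - 1) l j + j * transvectant_coeff s k i (l + 1) (j - 1) =
   (i + j - int s) * transvectant_coeff s k i l j"
proof (induction s arbitrary: k i l j)
  case 0
  show ?case by simp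
next
  case (Suc s)
  let ?T = "transvectant_coeff s"
  have IH1: "i * ?T k (i - 1) l (j - 1) + (j - 1) * ?T (k - 1) i (l + 1) (j - 2) =
      (i + j - 1 - int s) * ?T (k - 1) i l (j - 1)"
    using Suc.IH[of i "k - 1" l "j - 1"] by (simp add: algebra_simps)
  have IH2: "(i - 1) * ?T (k + 1) (i - 2) (l - 1) j + j * ?T k (i - 1) l (j - 1) =
      (i - 1 + j - int s) * ?T k (i - 1) (l - 1) j"
    using Suc.IH[of "i - 1" k "l - 1" j] by (simp add: algebra_simps)
  \<comment> \<open>The shifts \<open>k + 1\<close> and \<open>l + 1\<close> each contribute an
    extra \<open>i * j * ?T k (i - 1) l (j - 1)\<close>, with opposite signs. Once these cancel, the
    terms group into the left sides of \<open>IH1\<close> and \<open>IH2\<close>.\<close>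
  have "i * ((k + 1) * j * ?T k (i - 1) l (j - 1) - (i - 1) * l * ?T (k + 1) (i - 2) (l - 1) j) +
      j * (k * (j - 1) * ?T (k - 1) i (l + 1) (j - 2) - i * (l + 1) * ?T k (i - 1) l (j - 1)) =
      k * j * (i * ?T k (i - 1) l (j - 1) + (j - 1) * ?T (k - 1) i (l + 1) (j - 2)) -
      i * l * ((i - 1) * ?T (k + 1) (i - 2) (l - 1) j + j * ?T k (i - 1) l (j - 1))"
    by (simp add: algebra_simps)
  also have "\<dots> = (i + j - int (Suc s)) * transvectant_coeff (Suc s) k i l j"
    by (simp only: IH1 IH2) (simp add: algebra_simps)
  finally show ?case by simp
qed

text \<open>Exchanging x with y and x' with y' turns Omega into its negative.\<close>

lemma transvectant_coeff_flip:
  "transvectant_coeff s i k j l = (- 1) ^ s * transvectant_coeff s k i l j"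
proof (induction s arbitrary: k i l j)
  case (Suc s)
  show ?case
    using Suc.IH[of k "i - 1" "l - 1" j] Suc.IH[of "k - 1" i l "j - 1"]
    by (simp add: algebra_simps)
qed simp

text \<open>Exchanging the two factors, that is x with x' and y with y', also negates Omega. Odd
  transvectants of a module with itself are therefore antisymmetric.\<close>

lemma transvectant_coeff_swap:
  "transvectant_coeff s l j k i = (- 1) ^ s * transvectant_coeff s k i l j"
proof (induction s arbitrary: k i l j)
  case (Suc s)
  show ?case
    using Suc.IH[of k "i - 1" "l - 1" j] Suc.IH[of "k - 1" i l "j - 1"]
    by (simp add: algebra_simps)
qed simp

text \<open>The mirror image of \<open>transvectant_coeff_lower\<close> under the exchange of x and
  y, now for the operator y d/dx + y' d/dx' of e_2. The signs from the exchange form a common factor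
  and cancel.\<close>

lemma transvectant_coeff_raise:
  "k * transvectant_coeff s (k - 1) (i + 1) l j + l * transvectant_coeff s k i (l - 1) (j + 1) =
   (k + l - int s) * transvectant_coeff s k i l j"
proof -
  have "(- 1) ^ s * (k * transvectant_coeff s (k - 1) (i + 1) l j +
          l * transvectant_coeff s k i (l - 1) (j + 1)) =
        (- 1) ^ s * ((k + l - int s) * transvectant_coeff s k i l j)"
    using transvectant_coeff_lower[of k s i j l]
    by (simp add: transvectant_coeff_flip[of s i k j l]
        transvectant_coeff_flip[of s _ "k - 1"] transvectant_coeff_flip[of s _ k _ "l - 1"]
        distrib_left mult.left_commute)
  then show ?thesis by simp
qed

text \<open>Each application of Omega lowers the total degree in y and y' by one, so a monomial of
  degree less than \<open>s\<close> in them is killed by \<open>s\<close> applications. An exponent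
  that would become negative in the recursion comes with the factor 0.\<close>

lemma transvectant_coeff_eq_0_low:
  assumes "0 \<le> i" "0 \<le> j" "i + j < int s"
  shows "transvectant_coeff s k i l j = 0"
  using assms
proof (induction s arbitrary: k i l j)
  case (Suc s)
  have "j * transvectant_coeff s (k - 1) i l (j - 1) = 0"
    using Suc by (cases "j = 0") auto
  moreover have "i * transvectant_coeff s k (i - 1) (l - 1) j = 0"
    using Suc by (cases "i = 0") auto
  ultimately show ?case by auto
qed simp

lemma transvectant_coeff_eq_0_high:
  assumes "0 \<le> k" "0 \<le> l" "k + l < int s"
  shows "transvectant_coeff s k i l j = 0"
  using transvectant_coeff_eq_0_low[OF assms, of i j] by (simp add: transvectant_coeff_flip[of s i])

text \<open>Up to the constants of the two brackets, this is the coefficient of f_(i+j+k-8) in the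
  cyclic sum of [f_i, [f_j, f_k]] on g_1. The inner bracket is the transvectant of order 3 into g_3,
  with result of index j + k - 3 and x-exponent 6 - (j + k - 3) = 9 - j - k; the outer one has order
  5 and lands in g_4.\<close>

definition transvectant_jacobiator :: "int \<Rightarrow> int \<Rightarrow> int \<Rightarrow> int" where
  "transvectant_jacobiator i j k =
     transvectant_coeff 3 (6 - j) j (6 - k) k *
     transvectant_coeff 5 (6 - i) i (9 - j - k) (j + k - 3) +
     transvectant_coeff 3 (6 - k) k (6 - i) i *
     transvectant_coeff 5 (6 - j) j (9 - k - i) (k + i - 3) +
     transvectant_coeff 3 (6 - i) i (6 - j) j *
     transvectant_coeff 5 (6 - k) k (9 - i - j) (i + j - 3)"

lemma transvectant_jacobiator_cycle:
  "transvectant_jacobiator i j k = transvectant_jacobiator j k i"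
  by (simp add: transvectant_jacobiator_def algebra_simps)

lemma transvectant_jacobiator_swap:
  "transvectant_jacobiator i j k = - transvectant_jacobiator j i k"
proof -
  have "transvectant_coeff 3 (6 - y) y (6 - x) x = - transvectant_coeff 3 (6 - x) x (6 - y) y" for x y
    by (subst transvectant_coeff_swap) simp
  from this[of i k] this[of k j] this[of j i] show ?thesis
    by (simp add: transvectant_jacobiator_def algebra_simps)
qed

text \<open>As g_4 contains only f_0, f_1, f_2, only the sums 8, 9 and 10 matter. They leave
  thirteen increasing triples, which are evaluated explicitly.\<close>

lemma transvectant_jacobiator_sorted_eq_0:
  assumes "0 \<le> i" "i < j" "j < k" "k \<le> 6" "i + j + k \<in> {8..10}"
  shows "transvectant_jacobiator i j k = 0"
proof -
  have "(i, j, k) \<in> {(0, 2, 6), (0, 3, 5), (1, 2, 5), (1, 3, 4), (0, 3, 6), (0, 4, 5), (1, 2, 6),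
      (1, 3, 5), (2, 3, 4), (0, 4, 6), (1, 3, 6), (1, 4, 5), (2, 3, 5)}"
    using assms by simp presburger
  then show ?thesis
    by (auto simp: transvectant_jacobiator_def transvectant_coeff_numeral)
qed

text \<open>By total antisymmetry a repeated index gives zero, and each of the six orders of
  distinct indices reduces to the increasing one.\<close>

lemma transvectant_jacobiator_eq_0:
  assumes "i \<in> {0..6}" "j \<in> {0..6}" "k \<in> {0..6}" "i + j + k \<in> {8..10}"
  shows "transvectant_jacobiator i j k = 0"
proof -
  note cyc = transvectant_jacobiator_cycle and swap = transvectant_jacobiator_swap
  consider "i = j" | "j = k" | "i = k" | "i < j" "j < k" | "j < k" "k < i" | "k < i" "i < j" |
      "j < i" "i < k" | "i < k" "k < j" | "k < j" "j < i"
    by linarith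
  then show ?thesis
  proof cases
    case 1 then show ?thesis using swap[of i j k] by simp
  next
    case 2 then show ?thesis using swap[of j k i] cyc[of i j k] by simp
  next
    case 3 then show ?thesis using swap[of k i j] cyc[of k i j] by simp
  next
    case 4 then show ?thesis using assms transvectant_jacobiator_sorted_eq_0[of i j k] by simp
  next
    case 5 then show ?thesis
      using assms transvectant_jacobiator_sorted_eq_0[of j k i] cyc[of i j k] by simp
  next
    case 6 then show ?thesis
      using assms transvectant_jacobiator_sorted_eq_0[of k i j] cyc[of k i j] by simp
  next
    case 7 then show ?thesis
      using assms transvectant_jacobiator_sorted_eq_0[of j i k] swap[of i j k] by simp
  next
    case 8 then show ?thesis
      using assms transvectant_jacobiator_sorted_eq_0[of i k j] swap[of k i j] cyc[of k i j] by simp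
  next
    case 9 then show ?thesis
      using assms transvectant_jacobiator_sorted_eq_0[of k j i] swap[of j k i] cyc[of i j k] by simp
  qed
qed

section \<open>The graded pieces\<close>

text \<open>Two numbers in 1..25 differ by at most 24, so 25 divides the difference only if it is
  zero.\<close>

lemma of_nat_25_inj:
  assumes "(of_nat m :: 25) = of_nat n" "m \<in> {1..25}" "n \<in> {1..25}"
  shows "m = n"
  using assms
proof (induction m n rule: linorder_wlog)
  case (le m n)
  then have "(of_nat (n - m) :: 25) = 0" by (simp add: of_nat_diff)
  then have "25 dvd n - m" by (simp add: of_nat_eq_0_iff_char_dvd)
  with le show ?case by (auto dest: dvd_imp_le)
qed simp

lemma coord_evec:
  assumes "m \<in> {1..25}" "n \<in> {1..25}"
  shows "coord m (evec n) = (if m = n then 1 else 0)"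
  using of_nat_25_inj[of m n] assms by (auto simp: coord_def evec_def axis_def)

lemma span_evec: "vec.span (evec ` {1..25}) = UNIV"
proof -
  have "cart_basis \<subseteq> evec ` {1..25}"
  proof
    fix v :: "complex ^ 25" assume "v \<in> cart_basis"
    then obtain i :: 25 where v: "v = axis i 1" by (auto simp: cart_basis_def)
    obtain n :: nat where n: "i = of_nat n"
    proof -
      obtain z where z: "0 \<le> z" "i = of_int z" by (cases i) auto
      then have "i = of_nat (nat z)" by simp
      then show ?thesis by (rule that)
    qed
    have "(of_nat (25 * (n div 25)) :: 25) = 0"
      unfolding of_nat_eq_0_iff_char_dvd by simp
    then have "(of_nat (n mod 25 + 25 * (n div 25)) :: 25) = of_nat (n mod 25)"
      by (simp only: of_nat_add) simp
    then have mod: "(of_nat (n mod 25) :: 25) = i" by (simp add: n)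
    \<comment> \<open>The residue 0 is represented by 25, since the basis vectors are numbered from
      1.\<close>
    have "(of_nat (if n mod 25 = 0 then 25 else n mod 25) :: 25) = i"
      using mod by (cases "n mod 25 = 0") simp_all
    then have "evec (if n mod 25 = 0 then 25 else n mod 25) = v"
      by (simp only: v evec_def)
    moreover have "(if n mod 25 = 0 then 25 else n mod 25) \<in> {1..25}"
      by (auto simp: less_imp_le)
    ultimately show "v \<in> evec ` {1..25}" by blast
  qed
  then show ?thesis using vec.span_mono[of cart_basis] by auto
qed

lemma g_cases:
  assumes "p \<in> {1..4::nat}" obtains "p = 1" | "p = 2" | "p = 3" | "p = 4"
  using assms by fastforce

lemma coord_fvec:
  assumes "p \<in> {1..4}" "i \<in> {0..int (g_top p)}"
  shows "coord (g_first p + nat i) (fvec p k) = (if i = k then 1 else 0)"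
proof -
  have "g_first p + nat i \<in> {1..25}" if "i \<in> {0..int (g_top p)}" for i
    using assms(1) that by (cases rule: g_cases) (auto simp: g_first_def g_top_def)
  then show ?thesis
    using assms(2) by (auto simp: fvec_def coord_evec) (auto simp: coord_def)
qed

text \<open>
  \<open>f\<^sub>i\<close> corresponds to the monomial $x^{m-i} y^i$, on which $e_1$ acts as $x \partial_y$ and $e_2$
  as $y \partial_x$.
\<close>

definition transvectant :: "nat \<Rightarrow> nat \<Rightarrow> nat \<Rightarrow> nat \<Rightarrow> int \<Rightarrow> int \<Rightarrow> complex ^ 25" where
  "transvectant p q r s i j =
     of_int (transvectant_coeff s (int (g_top p) - i) i (int (g_top q) - j) j) *s
       fvec r (i + j - int s)"

lemma fvec_eq_0: "i \<notin> {0..int (g_top p)} \<Longrightarrow> fvec p i = 0"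
  by (auto simp: fvec_def)

lemma fvec_in_gsub: "fvec p i \<in> gsub p"
  by (cases "i \<in> {0..int (g_top p)}") (auto simp: gsub_def fvec_eq_0 vec.span_base vec.span_zero)

lemma gsub_expand:
  assumes "w \<in> gsub p"
  obtains c where "w = (\<Sum>i\<in>{0..int (g_top p)}. c i *s fvec p i)"
proof -
  have "\<exists>c. w = (\<Sum>i\<in>{0..int (g_top p)}. c i *s fvec p i)"
    using assms unfolding gsub_def
  proof (induction rule: vec.span_induct_alt)
    case base
    show ?case by (intro exI[of _ "\<lambda>_. 0"]) simp
  next
    case (step a x w)
    then obtain c k where "w = (\<Sum>i\<in>{0..int (g_top p)}. c i *s fvec p i)"
      and k: "x = fvec p k" "k \<in> {0..int (g_top p)}" by blast
    then show ?case
      by (intro exI[of _ "\<lambda>i. c i + (if i = k then a else 0)"])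
        (simp add: vector_sadd_rdistrib sum.distrib if_distrib[of "\<lambda>z. z *s _"]
          cong: if_cong)
  qed
  then show ?thesis using that by blast
qed

lemma coord_diff: "coord n (v - w) = coord n v - coord n w"
  and coord_scale: "coord n (z *s v) = z * coord n v"
  and coord_zero: "coord n 0 = 0"
  and coord_sum: "coord n (sum f A) = (\<Sum>x\<in>A. coord n (f x))"
  by (simp_all add: coord_def)

lemma fvec_nonzero:
  assumes "p \<in> {1..4}" "i \<in> {0..int (g_top p)}"
  shows "fvec p i \<noteq> 0"
  using coord_fvec[OF assms, of i] by (auto simp: coord_zero)

section \<open>Products satisfying the Jacobi identity\<close>

text \<open>The Jacobi identity is not assumed here, so both directions of the equivalence can be
  carried out in this locale.\<close>

locale graded_product =
  fixes br :: "complex ^ 25 \<Rightarrow> complex ^ 25 \<Rightarrow> complex ^ 25"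
  assumes considered: "considered_product br"
begin

lemma linear_right: "Vector_Spaces.linear (*s) (*s) (br x)"
  and linear_left: "Vector_Spaces.linear (*s) (*s) (\<lambda>x. br x y)"
  and self: "br x x = 0"
  using considered by (simp_all add: considered_product_def alternating_bilinear_def)

lemmas bilinear_simps =
  vec.linear_add[OF linear_right] vec.linear_add[OF linear_left]
  vec.linear_diff[OF linear_right] vec.linear_diff[OF linear_left]
  vec.linear_neg[OF linear_right] vec.linear_neg[OF linear_left]
  vec.linear_scale[OF linear_right] vec.linear_scale[OF linear_left]
  vec.linear_0[OF linear_right] vec.linear_0[OF linear_left]

lemma anticommute: "br x y = - br y x"
proof -
  have "br (x + y) (x + y) = 0" by (rule self)
  then have "br x y + br y x = 0" by (simp only: bilinear_simps) (simp add: self add.commute)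
  then show ?thesis by (simp add: eq_neg_iff_add_eq_0)
qed

lemma sl2_brackets:
  "br (evec 1) (evec 2) = evec 3" "br (evec 1) (evec 3) = (-2) *s evec 1"
  "br (evec 2) (evec 3) = 2 *s evec 2"
  using considered by (simp_all add: considered_product_def sl2_relations_def)

text \<open>The formula for the action persists for indices outside 0..m, where both sides vanish,
  with the exception of m + 1: there the right side would be (m + 1) f_m. Likewise
  \<open>raise\<close> fails only at -1, where it would give (m + 1) f_0.\<close>

lemma lower:
  assumes "p \<in> {1..4}" "i \<noteq> int (g_top p) + 1"
  shows "br (evec 1) (fvec p i) = of_int i *s fvec p (i - 1)"
proof (cases "i \<in> {0..int (g_top p)}")
  case True
  then show ?thesis
    using considered assms by (simp add: considered_product_def sl2_action_def)
next
  case False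
  then have "of_int i *s fvec p (i - 1) = 0"
    using assms(2) by (cases "i = 0") (auto intro: fvec_eq_0)
  then show ?thesis by (simp only: fvec_eq_0[OF False] bilinear_simps)
qed

lemma raise:
  assumes "p \<in> {1..4}" "i \<noteq> - 1"
  shows "br (evec 2) (fvec p i) = of_int (int (g_top p) - i) *s fvec p (i + 1)"
proof (cases "i \<in> {0..int (g_top p)}")
  case True
  then show ?thesis
    using considered assms by (simp add: considered_product_def sl2_action_def)
next
  case False
  then have "of_int (int (g_top p) - i) *s fvec p (i + 1) = 0"
    using assms(2) by (cases "i = int (g_top p)") (auto intro: fvec_eq_0)
  then show ?thesis by (simp only: fvec_eq_0[OF False] bilinear_simps)
qed

lemma weight:
  assumes "p \<in> {1..4}"
  shows "br (evec 3) (fvec p i) = of_int (int (g_top p) - 2 * i) *s fvec p i"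
proof (cases "i \<in> {0..int (g_top p)}")
  case True
  then show ?thesis
    using considered assms by (simp add: considered_product_def sl2_action_def)
next
  case False
  then show ?thesis by (simp add: fvec_eq_0 bilinear_simps)
qed

text \<open>The weights m - 2i of the basis vectors are pairwise distinct, so comparing coordinates
  in the eigenvalue equation kills every coefficient except the one at \<open>k\<close>.\<close>

lemma weight_space:
  assumes p: "p \<in> {1..4}" and w: "w \<in> gsub p"
    and eigen: "br (evec 3) w = of_int (int (g_top p) - 2 * k) *s w"
  obtains z where "w = z *s fvec p k"
proof -
  let ?I = "{0..int (g_top p)}"
  obtain c where c: "w = (\<Sum>i\<in>?I. c i *s fvec p i)"
    using w by (rule gsub_expand)
  have coord_w: "coord (g_first p + nat i) w = c i" if "i \<in> ?I" for i
    using that by (simp add: c coord_sum coord_scale coord_fvec[OF p that] if_distrib cong: if_cong)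
  have "c i = 0" if i: "i \<in> ?I" and "i \<noteq> k" for i
  proof -
    have "br (evec 3) w = (\<Sum>i\<in>?I. (of_int (int (g_top p) - 2 * i) * c i) *s fvec p i)"
      unfolding c vec.linear_sum[OF linear_right]
      by (intro sum.cong refl) (simp only: bilinear_simps weight[OF p] vector_smult_assoc mult.commute)
    then have "of_int (int (g_top p) - 2 * i) * c i = of_int (int (g_top p) - 2 * k) * coord (g_first p + nat i) w"
      using i by (simp only: eigen coord_scale[symmetric])
        (simp add: coord_sum coord_scale coord_fvec[OF p i] if_distrib cong: if_cong)
    with coord_w[OF i] \<open>i \<noteq> k\<close> show ?thesis by (simp add: algebra_simps)
  qed
  then have "w = (\<Sum>i\<in>?I. if i = k then c k *s fvec p k else 0)"
    unfolding c by (intro sum.cong) auto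
  \<comment> \<open>If \<open>k\<close> lies outside the index range, both sides are zero because
    \<open>fvec p k\<close> is.\<close>
  also have "\<dots> = c k *s fvec p k" by (auto simp: fvec_eq_0)
  finally show ?thesis by (rule that)
qed

lemma transvectant_in_gsub: "transvectant p q r s i j \<in> gsub r"
  unfolding transvectant_def using fvec_in_gsub[of r] by (simp add: gsub_def vec.span_scale)

section \<open>Equivariance of the transvectants\<close>

lemma lower_transvectant:
  assumes r: "r \<in> {1..4}" and deg: "2 * s + g_top r = g_top p + g_top q"
    and ij: "i \<in> {0..int (g_top p)}" "j \<in> {0..int (g_top q)}"
  shows "br (evec 1) (transvectant p q r s i j) =
    of_int i *s transvectant p q r s (i - 1) j + of_int j *s transvectant p q r s i (j - 1)"
proof -
  let ?T = "\<lambda>i j. transvectant_coeff s (int (g_top p) - i) i (int (g_top q) - j) j"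
  let ?k = "i + j - int s"
  have "br (evec 1) (of_int (?T i j) *s fvec r ?k) = of_int (?T i j) *s (of_int ?k *s fvec r (?k - 1))"
  proof (cases "?k = int (g_top r) + 1")
    case True
    then have "?T i j = 0"
      using ij deg by (intro transvectant_coeff_eq_0_high) auto
    then show ?thesis by (simp add: bilinear_simps)
  next
    case False
    then show ?thesis by (simp only: bilinear_simps lower[OF r False])
  qed
  also have "\<dots> = of_int (?k * ?T i j) *s fvec r (?k - 1)"
    by (simp only: vector_smult_assoc of_int_mult mult.commute)
  also have "?k * ?T i j = i * ?T (i - 1) j + j * ?T i (j - 1)"
    using transvectant_coeff_lower[of i s "int (g_top p) - i" "int (g_top q) - j" j]
    by (simp add: algebra_simps)
  also have "of_int \<dots> *s fvec r (?k - 1) =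
      of_int i *s (of_int (?T (i - 1) j) *s fvec r (?k - 1)) +
      of_int j *s (of_int (?T i (j - 1)) *s fvec r (?k - 1))"
    by (simp only: of_int_add of_int_mult vector_sadd_rdistrib vector_smult_assoc)
  finally show ?thesis by (simp add: transvectant_def algebra_simps)
qed

lemma raise_transvectant:
  assumes r: "r \<in> {1..4}" and deg: "2 * s + g_top r = g_top p + g_top q"
    and ij: "i \<in> {0..int (g_top p)}" "j \<in> {0..int (g_top q)}"
  shows "br (evec 2) (transvectant p q r s i j) =
    of_int (int (g_top p) - i) *s transvectant p q r s (i + 1) j +
    of_int (int (g_top q) - j) *s transvectant p q r s i (j + 1)"
proof -
  let ?T = "\<lambda>i j. transvectant_coeff s (int (g_top p) - i) i (int (g_top q) - j) j"
  let ?k = "i + j - int s"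
  have "br (evec 2) (of_int (?T i j) *s fvec r ?k) =
      of_int (?T i j) *s (of_int (int (g_top r) - ?k) *s fvec r (?k + 1))"
  proof (cases "?k = - 1")
    case True
    \<comment> \<open>The index excluded from \<open>raise\<close>: here i + j = s - 1, so the
      degree in y and y' is too small.\<close>
    then have "?T i j = 0"
      using ij deg by (intro transvectant_coeff_eq_0_low) auto
    then show ?thesis by (simp add: bilinear_simps)
  next
    case False
    then show ?thesis by (simp only: bilinear_simps raise[OF r False])
  qed
  also have "\<dots> = of_int ((int (g_top r) - ?k) * ?T i j) *s fvec r (?k + 1)"
    by (simp only: vector_smult_assoc of_int_mult mult.commute)
  also have "int (g_top r) - ?k = (int (g_top p) - i) + (int (g_top q) - j) - int s"
    using deg by simp
  also have "\<dots> * ?T i j = (int (g_top p) - i) * ?T (i + 1) j + (int (g_top q) - j) * ?T i (j + 1)"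
    using transvectant_coeff_raise[of "int (g_top p) - i" s i "int (g_top q) - j" j]
    by (simp add: diff_diff_eq)
  also have "of_int \<dots> *s fvec r (?k + 1) =
      of_int (int (g_top p) - i) *s (of_int (?T (i + 1) j) *s fvec r (?k + 1)) +
      of_int (int (g_top q) - j) *s (of_int (?T i (j + 1)) *s fvec r (?k + 1))"
    by (simp only: of_int_add of_int_mult vector_sadd_rdistrib vector_smult_assoc)
  finally show ?thesis by (simp add: transvectant_def algebra_simps)
qed

lemma weight_transvectant:
  assumes r: "r \<in> {1..4}" and deg: "2 * s + g_top r = g_top p + g_top q"
  shows "br (evec 3) (transvectant p q r s i j) =
    of_int (int (g_top p) - 2 * i) *s transvectant p q r s i j +
    of_int (int (g_top q) - 2 * j) *s transvectant p q r s i j"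
proof -
  have "int (g_top r) - 2 * (i + j - int s) = (int (g_top p) - 2 * i) + (int (g_top q) - 2 * j)"
    using deg by simp
  then show ?thesis
    unfolding transvectant_def bilinear_simps weight[OF r]
    by (simp only: of_int_add vector_sadd_rdistrib vector_smult_assoc mult.commute vector_add_ldistrib)
qed

section \<open>The Jacobiator and the rigidity of equivariant brackets\<close>

definition jacobiator :: "complex ^ 25 \<Rightarrow> complex ^ 25 \<Rightarrow> complex ^ 25 \<Rightarrow> complex ^ 25" where
  "jacobiator x y z = br x (br y z) + br y (br z x) + br z (br x y)"

lemma jacobi_iff: "jacobi br \<longleftrightarrow> (\<forall>x y z. jacobiator x y z = 0)"
  by (simp add: jacobi_def jacobiator_def)

text \<open>The Jacobiator measures the failure of bracketing with \<open>u\<close> to be a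
  derivation. For \<open>u\<close> in sl2 its vanishing is thus the equivariance of the bracket
  under \<open>u\<close>.\<close>

lemma jacobiator_derivation:
  "jacobiator u x y = br u (br x y) - br (br u x) y - br x (br u y)"
  using anticommute[of x "br u y"] anticommute[of y "br u x"] anticommute[of y u]
  by (simp add: jacobiator_def bilinear_simps)

definition given_by_transvectant :: "nat \<Rightarrow> nat \<Rightarrow> nat \<Rightarrow> nat \<Rightarrow> complex \<Rightarrow> bool" where
  "given_by_transvectant p q r s z \<longleftrightarrow>
     (\<forall>i\<in>{0..int (g_top p)}. \<forall>j\<in>{0..int (g_top q)}.
        br (fvec p i) (fvec q j) = z *s transvectant p q r s i j)"

text \<open>
  The defect \<open>D\<close> of the bracket from a multiple of the transvectant is \<open>sl\<^sub>2\<close>-equivariant, and by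
  weights \<open>D i j\<close> is a multiple of \<open>f\<^sub>k\<close> with \<open>k = i + j - s\<close>. On the level \<open>k = 0\<close> all values are
  tied together by $e_2$, since the level \<open>k = - 1\<close> vanishes, and one of them is zero by the
  normalisation. As $e_1$ kills no \<open>f\<^sub>k\<close> with \<open>k > 0\<close>, the higher levels follow by induction.
\<close>

lemma jacobi_imp_given_by_transvectant:
  assumes jac: "jacobi br" and pqr: "p \<in> {1..4}" "q \<in> {1..4}" "r \<in> {1..4}"
    and shape: "\<And>x y. x \<in> gsub p \<Longrightarrow> y \<in> gsub q \<Longrightarrow> br x y \<in> gsub r"
    and deg: "2 * s + g_top r = g_top p + g_top q" and s: "s \<le> g_top p" "s \<le> g_top q"
    and norm: "coord (g_first r) (br (fvec p 0) (fvec q (int s))) =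
      z * of_int (transvectant_coeff s (int (g_top p)) 0 (int (g_top q) - int s) (int s))"
  shows "given_by_transvectant p q r s z"
proof -
  let ?m = "int (g_top p)" and ?n = "int (g_top q)" and ?t = "int (g_top r)"
  define D where "D i j = br (fvec p i) (fvec q j) - z *s transvectant p q r s i j" for i j
  have derivation: "br u (br x y) = br (br u x) y + br x (br u y)" for u x y
    using jac jacobiator_derivation[of u x y] by (simp add: jacobi_iff algebra_simps)
  have D_lower: "br (evec 1) (D i j) = of_int i *s D (i - 1) j + of_int j *s D i (j - 1)"
    if "i \<in> {0..?m}" "j \<in> {0..?n}" for i j
    using that
    by (simp add: D_def bilinear_simps derivation[of "evec 1"] lower[OF pqr(1)] lower[OF pqr(2)]
        lower_transvectant[OF pqr(3) deg]
        vector_ssub_ldistrib vector_add_ldistrib vector_smult_assoc mult.commute algebra_simps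
        del: One_nat_def)
  have D_raise: "br (evec 2) (D i j) = of_int (?m - i) *s D (i + 1) j + of_int (?n - j) *s D i (j + 1)"
    if "i \<in> {0..?m}" "j \<in> {0..?n}" for i j
    using that
    by (simp add: D_def bilinear_simps derivation[of "evec 2"] raise[OF pqr(1)] raise[OF pqr(2)]
        raise_transvectant[OF pqr(3) deg]
        vector_ssub_ldistrib vector_add_ldistrib vector_smult_assoc mult.commute algebra_simps
        del: of_int_diff One_nat_def)
  have D_weight: "br (evec 3) (D i j) = of_int (?m - 2 * i) *s D i j + of_int (?n - 2 * j) *s D i j" for i j
    by (simp add: D_def bilinear_simps derivation[of "evec 3"] weight[OF pqr(1)] weight[OF pqr(2)]
        weight_transvectant[OF pqr(3) deg]
        vector_ssub_ldistrib vector_add_ldistrib vector_smult_assoc mult.commute algebra_simps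
        del: of_int_diff One_nat_def)
  have D_multiple: "\<exists>x. D i j = x *s fvec r (i + j - int s)" for i j
  proof -
    have "D i j \<in> gsub r"
      using shape[OF fvec_in_gsub fvec_in_gsub] transvectant_in_gsub[of p q r s]
      by (simp add: D_def gsub_def vec.span_diff vec.span_scale)
    moreover have "?t - 2 * (i + j - int s) = (?m - 2 * i) + (?n - 2 * j)"
      using deg by simp
    then have "br (evec 3) (D i j) = of_int (?t - 2 * (i + j - int s)) *s D i j"
      by (simp only: D_weight of_int_add vector_sadd_rdistrib)
    ultimately show ?thesis
      using weight_space[OF pqr(3)] by metis
  qed
  have level_0: "D (int i) (int s - int i) = 0" if "i \<le> s" for i
    using that
  proof (induction i)
    case 0
    obtain x where x: "D 0 (int s) = x *s fvec r 0" using D_multiple[of 0 "int s"] by auto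
    have f0: "coord (g_first r) (fvec r 0) = 1"
      using coord_fvec[OF pqr(3), of 0 0] by simp
    have "coord (g_first r) (D 0 (int s)) = 0"
      by (simp add: D_def coord_diff coord_scale norm transvectant_def f0)
    then have "x = 0" by (simp add: x coord_scale f0)
    then show ?case by (simp add: x)
  next
    case (Suc i)
    \<comment> \<open>This defect is a multiple of f_(-1) = 0. Applying e_2 to it relates two
      neighbours on level 0; one vanishes by induction, and the coefficient m - i of the other is
      nonzero because i < s <= m.\<close>
    have "D (int i) (int s - int i - 1) = 0"
      using D_multiple[of "int i" "int s - int i - 1"] by (simp add: fvec_eq_0)
    then have "of_int (?m - int i) *s D (int i + 1) (int s - int i - 1) = 0"
      using D_raise[of "int i" "int s - int i - 1"] Suc s by (simp add: bilinear_simps)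
    moreover have "of_int (?m - int i) \<noteq> (0 :: complex)"
      using Suc.prems s by (simp only: of_int_eq_0_iff)
    ultimately show ?case by (simp add: add.commute diff_diff_eq del: of_int_diff One_nat_def)
  qed
  have "D i j = 0" if "i \<in> {0..?m}" "j \<in> {0..?n}" for i j
    using that
  proof (induction "nat (i + j - int s)" arbitrary: i j rule: less_induct)
    case less
    let ?k = "i + j - int s"
    obtain x where x: "D i j = x *s fvec r ?k" using D_multiple by blast
    consider "?k \<notin> {0..?t}" | "?k = 0" | "?k \<in> {1..?t}" by force
    then show ?case
    proof cases
      case 1
      then show ?thesis by (simp add: x fvec_eq_0)
    next
      case 2
      then have "i = int (nat i)" "j = int s - int (nat i)" "nat i \<le> s" using less.prems by auto
      then show ?thesis using level_0 by metis
    next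
      case 3
      \<comment> \<open>For i = 0 the induction hypothesis does not cover index -1, but the
        coefficient is zero; the same holds for j below.\<close>
      have "of_int i *s D (i - 1) j = 0"
        using less.prems 3 less.hyps[of "i - 1" j] by (cases "i = 0") auto
      moreover have "of_int j *s D i (j - 1) = 0"
        using less.prems 3 less.hyps[of i "j - 1"] by (cases "j = 0") auto
      ultimately have "br (evec 1) (x *s fvec r ?k) = 0"
        using D_lower[OF less.prems] by (simp only: x add_0_right)
      moreover have "br (evec 1) (x *s fvec r ?k) = (x * of_int ?k) *s fvec r (?k - 1)"
      proof -
        have "br (evec 1) (fvec r ?k) = of_int ?k *s fvec r (?k - 1)"
          using 3 by (intro lower pqr) auto
        then show ?thesis by (simp only: bilinear_simps vector_smult_assoc)
      qed
      ultimately have "(x * of_int ?k) *s fvec r (?k - 1) = 0" by (simp only:)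
      moreover have "fvec r (?k - 1) \<noteq> 0" using 3 by (intro fvec_nonzero pqr) auto
      ultimately have "x * of_int ?k = 0" by (simp only: vec.scale_eq_0_iff simp_thms)
      then have "x = 0" using 3 by (simp only: mult_eq_0_iff of_int_eq_0_iff) auto
      then show ?thesis by (simp add: x)
    qed
  qed
  then show ?thesis by (simp add: given_by_transvectant_def D_def)
qed

end

section \<open>Transvectants satisfy the Jacobi identity\<close>

lemma evec_eq_fvec:
  "i \<in> {0..int (g_top p)} \<Longrightarrow> evec (g_first p + nat i) = fvec p i"
  by (simp add: fvec_def)

lemma g_index_cases:
  assumes "n \<in> {4..25}"
  obtains p i where "p \<in> {1..4}" "i \<in> {0..int (g_top p)}" "n = g_first p + nat i"
proof -
  consider "n \<in> {4..10}" | "n \<in> {11..15}" | "n \<in> {16..22}" | "n \<in> {23..25}"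
    using assms by force
  then show ?thesis
  proof cases
    case 1 then show ?thesis by (intro that[of 1 "int n - 4"]) (auto simp: g_first_def g_top_def)
  next
    case 2 then show ?thesis by (intro that[of 2 "int n - 11"]) (auto simp: g_first_def g_top_def)
  next
    case 3 then show ?thesis by (intro that[of 3 "int n - 16"]) (auto simp: g_first_def g_top_def)
  next
    case 4 then show ?thesis by (intro that[of 4 "int n - 23"]) (auto simp: g_first_def g_top_def)
  qed
qed

context graded_product
begin

section \<open>Reduction to basis vectors\<close>

lemma jacobiator_cycle: "jacobiator x y z = jacobiator y z x"
  by (simp add: jacobiator_def add_ac)

lemma jacobiator_swap: "jacobiator x y z = - jacobiator y x z"
  using anticommute[of y z] anticommute[of z x] anticommute[of x y]
  by (simp add: jacobiator_def bilinear_simps)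

text \<open>A cyclic rotation brings every mixed triple into one of the listed patterns, with the
  members of \<open>S\<close> first.\<close>

lemma jacobiator_eq_0_on_Un:
  assumes "\<And>u v w. u \<in> S \<Longrightarrow> v \<in> S \<Longrightarrow> w \<in> S \<Longrightarrow> jacobiator u v w = 0"
    and "\<And>u v w. u \<in> S \<Longrightarrow> v \<in> S \<Longrightarrow> w \<in> G \<Longrightarrow> jacobiator u v w = 0"
    and "\<And>u v w. u \<in> S \<Longrightarrow> v \<in> G \<Longrightarrow> w \<in> G \<Longrightarrow> jacobiator u v w = 0"
    and "\<And>u v w. u \<in> G \<Longrightarrow> v \<in> G \<Longrightarrow> w \<in> G \<Longrightarrow> jacobiator u v w = 0"
    and "u \<in> S \<union> G" "v \<in> S \<union> G" "w \<in> S \<union> G"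
  shows "jacobiator u v w = 0"
  using assms(5-7) assms(1-4)[of u v w] assms(2,3)[of v w u] assms(2,3)[of w u v]
    jacobiator_cycle[of u v w] jacobiator_cycle[of v w u]
  by auto

lemma jacobi_if_basis:
  assumes basis: "\<And>k l n. k \<in> {1..25} \<Longrightarrow> l \<in> {1..25} \<Longrightarrow> n \<in> {1..25} \<Longrightarrow>
    jacobiator (evec k) (evec l) (evec n) = 0"
  shows "jacobi br"
proof -
  \<comment> \<open>The span argument is made for the first slot only; rotating the Jacobiator
    brings each of the other slots there in turn.\<close>
  have extend: "\<forall>x. jacobiator x y z = 0"
    if "\<And>k. k \<in> {1..25} \<Longrightarrow> jacobiator (evec k) y z = 0" for y z
  proof -
    have "vec.subspace {x. jacobiator x y z = 0}"
    proof (rule vec.subspaceI)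
      fix u v assume "u \<in> {x. jacobiator x y z = 0}" "v \<in> {x. jacobiator x y z = 0}"
      moreover have "jacobiator (u + v) y z = jacobiator u y z + jacobiator v y z"
        by (simp add: jacobiator_def bilinear_simps)
      ultimately show "u + v \<in> {x. jacobiator x y z = 0}" by simp
    next
      fix c u assume "u \<in> {x. jacobiator x y z = 0}"
      moreover have "jacobiator (c *s u) y z = c *s jacobiator u y z"
        by (simp add: jacobiator_def bilinear_simps vector_add_ldistrib)
      ultimately show "c *s u \<in> {x. jacobiator x y z = 0}" by simp
    qed (simp add: jacobiator_def bilinear_simps)
    then have "vec.span (evec ` {1..25}) \<subseteq> {x. jacobiator x y z = 0}"
      using that by (intro vec.span_minimal) auto
    then show ?thesis unfolding span_evec by blast
  qed
  have "jacobiator x (evec l) (evec n) = 0" if "l \<in> {1..25}" "n \<in> {1..25}" for x l n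
    using extend[of "evec l" "evec n"] basis that by blast
  then have "jacobiator y (evec n) x = 0" if "n \<in> {1..25}" for x y n
    using extend[of "evec n" x] jacobiator_cycle that by metis
  then have "jacobiator z x y = 0" for x y z
    using extend[of x y] jacobiator_cycle by metis
  then show ?thesis by (simp add: jacobi_iff)
qed

text \<open>Anticommutativity frees the shape conditions from the order of \<open>p\<close> and
  \<open>q\<close>. The second conclusion is coarse on purpose: landing in g_4 is enough to make any
  further bracket with some g_i vanish.\<close>

lemma bracket_shape:
  assumes "x \<in> gsub p" "y \<in> gsub q"
  shows "p = 1 \<Longrightarrow> q = 1 \<Longrightarrow> br x y \<in> gsub 3"
    and "p \<in> {1..4} \<Longrightarrow> q \<in> {1..4} \<Longrightarrow> (p, q) \<noteq> (1, 1) \<Longrightarrow> br x y \<in> gsub 4"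
    and "p \<in> {1..4} \<Longrightarrow> q \<in> {1..4} \<Longrightarrow>
      (p, q) \<notin> {(1, 1), (1, 2), (2, 1), (2, 2), (1, 3), (3, 1)} \<Longrightarrow> br x y = 0"
proof -
  have shape: "nilradical_shape br"
    using considered by (simp add: considered_product_def)
  show "p = 1 \<Longrightarrow> q = 1 \<Longrightarrow> br x y \<in> gsub 3"
    using shape assms by (simp add: nilradical_shape_def)
  have zero: "br x y = 0"
    if "p \<in> {1..4}" "q \<in> {1..4}" "p \<le> q" "(p, q) \<notin> {(1, 1), (1, 2), (2, 2), (1, 3)}"
      "x \<in> gsub p" "y \<in> gsub q" for p q x y
  proof -
    have "\<forall>i j. 1 \<le> i \<and> i \<le> j \<and> j \<le> 4 \<and> (i, j) \<notin> {(1, 1), (1, 2), (2, 2), (1, 3)} \<longrightarrow>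
        (\<forall>x\<in>gsub i. \<forall>y\<in>gsub j. br x y = 0)"
      using shape unfolding nilradical_shape_def by (elim conjE)
    moreover have "1 \<le> p" "q \<le> 4" using that by auto
    ultimately show ?thesis using that(3-6) by blast
  qed
  then show zero': "br x y = 0"
    if "p \<in> {1..4}" "q \<in> {1..4}" "(p, q) \<notin> {(1, 1), (1, 2), (2, 1), (2, 2), (1, 3), (3, 1)}"
  proof (cases "p \<le> q")
    case False
    then have "br y x = 0" using that assms by (intro zero[of q p]) auto
    then show ?thesis by (simp add: anticommute[of x y])
  qed (use that assms in \<open>auto intro: zero[of p q]\<close>)
  show "br x y \<in> gsub 4" if "p \<in> {1..4}" "q \<in> {1..4}" "(p, q) \<noteq> (1, 1)"
  proof (cases "(p, q) \<in> {(1, 2), (2, 1), (2, 2), (1, 3), (3, 1)}")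
    case True
    then have "br x y \<in> gsub 4 \<or> br y x \<in> gsub 4"
      using shape assms by (auto simp: nilradical_shape_def)
    then show ?thesis
      using anticommute[of x y] by (auto simp: gsub_def vec.span_neg)
  next
    case False
    then have "br x y = 0" using that by (intro zero') auto
    then show ?thesis by (simp add: gsub_def vec.span_zero)
  qed
qed

section \<open>The Jacobiator on each type of triple\<close>

lemma sl2_preserves:
  assumes "u \<in> {evec 1, evec 2, evec 3}" "p \<in> {1..4}" "i \<in> {0..int (g_top p)}"
  shows "br u (fvec p i) \<in> gsub p"
proof -
  have "z *s fvec p k \<in> gsub p" for z k
    using fvec_in_gsub[of p k] by (simp add: gsub_def vec.span_scale)
  moreover have "br (evec 1) (fvec p i) = of_int i *s fvec p (i - 1)"
    "br (evec 2) (fvec p i) = of_int (int (g_top p) - i) *s fvec p (i + 1)"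
    "br (evec 3) (fvec p i) = of_int (int (g_top p) - 2 * i) *s fvec p i"
    using assms(3) by (intro lower[OF assms(2)] raise[OF assms(2)] weight[OF assms(2)]; simp)+
  ultimately show ?thesis
    using assms(1) by (metis empty_iff insert_iff)
qed

lemma jacobiator_sl2_sl2_sl2:
  assumes "u \<in> {evec 1, evec 2, evec 3}" "v \<in> {evec 1, evec 2, evec 3}" "w \<in> {evec 1, evec 2, evec 3}"
  shows "jacobiator u v w = 0"
proof -
  have "br (evec 2) (evec 1) = - evec 3" "br (evec 3) (evec 1) = 2 *s evec 1"
    "br (evec 3) (evec 2) = - (2 *s evec 2)"
    using anticommute[of "evec 2" "evec 1"] anticommute[of "evec 3" "evec 1"]
      anticommute[of "evec 3" "evec 2"] by (simp_all add: sl2_brackets del: One_nat_def)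
  with assms show ?thesis
    by (auto simp: jacobiator_def sl2_brackets bilinear_simps self simp del: One_nat_def)
qed

text \<open>This is the statement that each g_p is an sl2-module. By antisymmetry three pairs of
  generators suffice, and each yields an integer identity for the coefficient of a single basis
  vector.\<close>

lemma jacobiator_sl2_sl2_module:
  assumes u: "u \<in> {evec 1, evec 2, evec 3}" and v: "v \<in> {evec 1, evec 2, evec 3}"
    and p: "p \<in> {1..4}" and i: "i \<in> {0..int (g_top p)}"
  shows "jacobiator u v (fvec p i) = 0"
proof -
  have lower_i: "br (evec 1) (fvec p i) = of_int i *s fvec p (i - 1)"
    using i by (intro lower[OF p]) auto
  have raise_i: "br (evec 2) (fvec p i) = of_int (int (g_top p) - i) *s fvec p (i + 1)"
    using i by (intro raise[OF p]) auto
  \<comment> \<open>At i = m, where \<open>lower\<close> does not apply to f_(m+1), the factor m - i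
    is zero; similarly at i = 0 in \<open>rl\<close>.\<close>
  have lr: "br (evec 1) (of_int (int (g_top p) - i) *s fvec p (i + 1)) =
      of_int ((int (g_top p) - i) * (i + 1)) *s fvec p i"
    by (cases "i = int (g_top p)")
      (simp_all add: bilinear_simps lower[OF p] vector_smult_assoc del: of_int_diff of_int_add One_nat_def)
  have rl: "br (evec 2) (of_int i *s fvec p (i - 1)) =
      of_int (i * (int (g_top p) - i + 1)) *s fvec p i"
    by (cases "i = 0")
      (simp_all add: bilinear_simps raise[OF p] vector_smult_assoc algebra_simps)
  have diff: "of_int a *s w - of_int b *s w - of_int c *s w = of_int (a - b - c) *s w"
    for a b c and w :: "complex ^ 25"
    by (simp only: of_int_diff vec.scale_left_diff_distrib)
  note eval = jacobiator_derivation lower_i raise_i lr rl sl2_brackets weight[OF p]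
    bilinear_simps vector_smult_assoc of_int_mult of_int_minus of_int_numeral
  have "jacobiator (evec 1) (evec 2) (fvec p i) =
      of_int ((int (g_top p) - i) * (i + 1)) *s fvec p i -
      of_int (int (g_top p) - 2 * i) *s fvec p i -
      of_int (i * (int (g_top p) - i + 1)) *s fvec p i"
    by (simp only: jacobiator_derivation lower_i raise_i lr rl sl2_brackets weight[OF p])
  then have "jacobiator (evec 1) (evec 2) (fvec p i) = 0"
    unfolding diff by (simp add: algebra_simps)
  moreover have "jacobiator (evec 1) (evec 3) (fvec p i) =
      of_int ((int (g_top p) - 2 * i) * i) *s fvec p (i - 1) -
      of_int ((- 2) * i) *s fvec p (i - 1) -
      of_int (i * (int (g_top p) - 2 * (i - 1))) *s fvec p (i - 1)"
    by (simp only: eval)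
  then have "jacobiator (evec 1) (evec 3) (fvec p i) = 0"
    unfolding diff by (simp add: algebra_simps)
  moreover have "jacobiator (evec 2) (evec 3) (fvec p i) =
      of_int ((int (g_top p) - 2 * i) * (int (g_top p) - i)) *s fvec p (i + 1) -
      of_int (2 * (int (g_top p) - i)) *s fvec p (i + 1) -
      of_int ((int (g_top p) - i) * (int (g_top p) - 2 * (i + 1))) *s fvec p (i + 1)"
    by (simp only: eval)
  then have "jacobiator (evec 2) (evec 3) (fvec p i) = 0"
    unfolding diff by (simp add: algebra_simps)
  moreover have "jacobiator u u w = 0" for u w
    by (simp add: jacobiator_derivation self bilinear_simps)
  moreover note jacobiator_swap[of "evec 2" "evec 1"] jacobiator_swap[of "evec 3" "evec 1"]
    jacobiator_swap[of "evec 3" "evec 2"]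
  ultimately show ?thesis using u v by (auto simp del: One_nat_def)
qed

text \<open>The bracket inherits equivariance from the transvectant of which it is a
  multiple.\<close>

lemma jacobiator_sl2_given:
  assumes u: "u \<in> {evec 1, evec 2, evec 3}" and pqr: "p \<in> {1..4}" "q \<in> {1..4}" "r \<in> {1..4}"
    and deg: "2 * s + g_top r = g_top p + g_top q"
    and given: "given_by_transvectant p q r s z"
    and ij: "i \<in> {0..int (g_top p)}" "j \<in> {0..int (g_top q)}"
  shows "jacobiator u (fvec p i) (fvec q j) = 0"
proof -
  have br_fvec: "br (fvec p i) (fvec q j) = z *s transvectant p q r s i j"
    if "i \<in> {0..int (g_top p)}" "j \<in> {0..int (g_top q)}" for i j
    using given that by (simp add: given_by_transvectant_def)
  \<comment> \<open>The action may shift an index out of the range covered by \<open>given\<close>,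
    but only with coefficient 0.\<close>
  have coeff: "c *s br (fvec p i) (fvec q j) = c *s (z *s transvectant p q r s i j)"
    if "c = 0 \<or> i \<in> {0..int (g_top p)} \<and> j \<in> {0..int (g_top q)}" for c i j
    using that br_fvec by (cases "c = 0") auto
  have "jacobiator (evec 1) (fvec p i) (fvec q j) =
      z *s br (evec 1) (transvectant p q r s i j) -
      of_int i *s br (fvec p (i - 1)) (fvec q j) - of_int j *s br (fvec p i) (fvec q (j - 1))"
    using ij by (simp add: jacobiator_derivation br_fvec bilinear_simps lower[OF pqr(1)] lower[OF pqr(2)]
        del: One_nat_def)
  also have "\<dots> = 0"
    using ij by (subst (1 2) coeff) (auto simp: lower_transvectant[OF pqr(3) deg] vector_add_ldistrib
        vector_smult_assoc mult.commute simp del: One_nat_def)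
  finally have 1: "jacobiator (evec 1) (fvec p i) (fvec q j) = 0" .
  have "jacobiator (evec 2) (fvec p i) (fvec q j) =
      z *s br (evec 2) (transvectant p q r s i j) -
      of_int (int (g_top p) - i) *s br (fvec p (i + 1)) (fvec q j) -
      of_int (int (g_top q) - j) *s br (fvec p i) (fvec q (j + 1))"
    using ij by (simp add: jacobiator_derivation br_fvec bilinear_simps raise[OF pqr(1)] raise[OF pqr(2)]
        del: of_int_diff)
  also have "\<dots> = 0"
    using ij by (subst (1 2) coeff) (auto simp: raise_transvectant[OF pqr(3) deg] vector_add_ldistrib
        vector_smult_assoc mult.commute simp del: of_int_diff)
  finally have 2: "jacobiator (evec 2) (fvec p i) (fvec q j) = 0" .
  have 3: "jacobiator (evec 3) (fvec p i) (fvec q j) = 0"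
    using ij by (simp add: jacobiator_derivation br_fvec bilinear_simps weight[OF pqr(1)] weight[OF pqr(2)]
        weight_transvectant[OF pqr(3) deg] vector_add_ldistrib vector_smult_assoc mult.commute
        del: of_int_diff)
  from u 1 2 3 show ?thesis by auto
qed

text \<open>Unless all three arguments lie in g_1, every double bracket vanishes: the inner bracket
  is in g_4, which has zero bracket with every g_i, or it is in g_3 and the outer factor is not in
  g_1. On g_1 the claim reduces to \<open>transvectant_jacobiator_eq_0\<close>.\<close>

lemma jacobiator_nilradical:
  assumes g: "given_by_transvectant 1 1 3 3 \<alpha>" "given_by_transvectant 1 3 4 5 \<delta>"
    and pqr: "p \<in> {1..4}" "q \<in> {1..4}" "r \<in> {1..4}"
    and ijk: "i \<in> {0..int (g_top p)}" "j \<in> {0..int (g_top q)}" "k \<in> {0..int (g_top r)}"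
  shows "jacobiator (fvec p i) (fvec q j) (fvec r k) = 0"
proof (cases "p = 1 \<and> q = 1 \<and> r = 1")
  case False
  have zero: "br x (br y z) = 0"
    if "x \<in> gsub p" "y \<in> gsub q" "z \<in> gsub r" "p \<in> {1..4}" "q \<in> {1..4}" "r \<in> {1..4}"
      "\<not> (p = 1 \<and> q = 1 \<and> r = 1)" for p q r x y z
  proof (cases "q = 1 \<and> r = 1")
    case True
    then have "br y z \<in> gsub 3" using that bracket_shape(1) by blast
    then show ?thesis using that True by (intro bracket_shape(3)[of x p _ 3]) auto
  next
    case False
    then have "br y z \<in> gsub 4" using that by (intro bracket_shape(2)[of y q z r]) auto
    then show ?thesis using that by (intro bracket_shape(3)[of x p _ 4]) auto
  qed
  have "br (fvec p i) (br (fvec q j) (fvec r k)) = 0"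
    "br (fvec q j) (br (fvec r k) (fvec p i)) = 0" "br (fvec r k) (br (fvec p i) (fvec q j)) = 0"
    using False pqr by (blast intro: zero[OF fvec_in_gsub fvec_in_gsub fvec_in_gsub])+
  then show ?thesis by (simp add: jacobiator_def)
next
  case True
  have nested: "br (fvec 1 i) (br (fvec 1 j) (fvec 1 k)) =
      (\<alpha> * \<delta> * of_int (transvectant_coeff 3 (6 - j) j (6 - k) k *
        transvectant_coeff 5 (6 - i) i (9 - j - k) (j + k - 3))) *s fvec 4 (i + j + k - 8)"
    if "i \<in> {0..6}" "j \<in> {0..6}" "k \<in> {0..6}" for i j k
  proof -
    let ?T = "transvectant_coeff 3 (6 - j) j (6 - k) k"
    have jk: "br (fvec 1 j) (fvec 1 k) = (\<alpha> * of_int ?T) *s fvec 3 (j + k - 3)"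
      using g(1) that by (simp add: given_by_transvectant_def transvectant_def g_top_def vector_smult_assoc)
    show ?thesis
    proof (cases "j + k - 3 \<in> {0..6}")
      case True
      then have "br (fvec 1 i) (fvec 3 (j + k - 3)) =
          (\<delta> * of_int (transvectant_coeff 5 (6 - i) i (9 - j - k) (j + k - 3))) *s fvec 4 (i + j + k - 8)"
        using g(2) that
        by (simp add: given_by_transvectant_def transvectant_def g_top_def vector_smult_assoc algebra_simps)
      then show ?thesis by (simp only: jk bilinear_simps vector_smult_assoc of_int_mult mult_ac)
    next
      case False
      \<comment> \<open>When f_(j+k-3) is out of range, \<open>g(2)\<close> says nothing about it;
        the formula still holds as the inner coefficient vanishes, for lack of degree in y if j + k
        < 3 and in x if j + k > 9.\<close>
      then have "?T = 0"
        using that transvectant_coeff_eq_0_low[of j k 3] transvectant_coeff_eq_0_high[of "6 - j" "6 - k" 3]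
        by auto
      then show ?thesis by (simp add: jk bilinear_simps del: One_nat_def)
    qed
  qed
  have ijk': "i \<in> {0..6}" "j \<in> {0..6}" "k \<in> {0..6}"
    using ijk True by (simp_all add: g_top_def)
  have "jacobiator (fvec 1 i) (fvec 1 j) (fvec 1 k) =
      (\<alpha> * \<delta> * of_int (transvectant_jacobiator i j k)) *s fvec 4 (i + j + k - 8)"
    unfolding jacobiator_def nested[OF ijk'(1,2,3)] nested[OF ijk'(2,3,1)] nested[OF ijk'(3,1,2)]
      transvectant_jacobiator_def
    by (simp only: of_int_add distrib_left vector_sadd_rdistrib add.commute[of j] add.commute[of k i] add.assoc)
      (simp add: algebra_simps)
  also have "\<dots> = 0"
  proof (cases "i + j + k \<in> {8..10}")
    case True
    then show ?thesis using transvectant_jacobiator_eq_0[OF ijk'] by simp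
  qed (auto simp: fvec_def g_top_def)
  finally show ?thesis using True by simp
qed

lemma given_by_transvectant_imp_jacobi:
  assumes g: "given_by_transvectant 1 1 3 3 \<alpha>" "given_by_transvectant 1 2 4 4 \<beta>"
    "given_by_transvectant 2 2 4 3 \<gamma>" "given_by_transvectant 1 3 4 5 \<delta>"
  shows "jacobi br"
proof (rule jacobi_if_basis)
  fix k l n :: nat assume kln: "k \<in> {1..25}" "l \<in> {1..25}" "n \<in> {1..25}"
  let ?S = "{evec 1, evec 2, evec 3}"
  let ?G = "{v. \<exists>p\<in>{1..4}. \<exists>i\<in>{0..int (g_top p)}. v = fvec p i}"
  have SSG: "jacobiator u v w = 0" if "u \<in> ?S" "v \<in> ?S" "w \<in> ?G" for u v w
    using that jacobiator_sl2_sl2_module by blast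
  have le: "jacobiator u (fvec p i) (fvec q j) = 0"
    if u: "u \<in> ?S" and pq: "p \<in> {1..4}" "q \<in> {1..4}" "p \<le> q"
      and ij: "i \<in> {0..int (g_top p)}" "j \<in> {0..int (g_top q)}" for u p q i j
  proof -
    consider "p = 1" "q = 1" | "p = 1" "q = 2" | "p = 2" "q = 2" | "p = 1" "q = 3" |
      "(p, q) \<notin> {(1, 1), (1, 2), (2, 1), (2, 2), (1, 3), (3, 1)}"
      using \<open>p \<le> q\<close> by auto
    then show ?thesis
    proof cases
      case 1 then show ?thesis
        using g(1) u ij by (intro jacobiator_sl2_given[where r = 3]) (auto simp: g_top_def)
    next
      case 2 then show ?thesis
        using g(2) u ij by (intro jacobiator_sl2_given[where r = 4]) (auto simp: g_top_def)
    next
      case 3 then show ?thesis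
        using g(3) u ij by (intro jacobiator_sl2_given[where r = 4]) (auto simp: g_top_def)
    next
      case 4 then show ?thesis
        using g(4) u ij by (intro jacobiator_sl2_given[where r = 4]) (auto simp: g_top_def)
    next
      case 5
      \<comment> \<open>Since sl2 preserves g_p and g_q, whose mutual bracket is zero, all three
        terms of the Jacobiator vanish.\<close>
      note zero = bracket_shape(3)[OF _ _ pq(1,2) 5]
      show ?thesis
        using zero[OF fvec_in_gsub fvec_in_gsub] zero[OF sl2_preserves[OF u pq(1) ij(1)] fvec_in_gsub]
          zero[OF fvec_in_gsub sl2_preserves[OF u pq(2) ij(2)]]
        by (simp add: jacobiator_derivation bilinear_simps)
    qed
  qed
  have SGG: "jacobiator u v w = 0" if u: "u \<in> ?S" and vw: "v \<in> ?G" "w \<in> ?G" for u v w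
  proof -
    from vw obtain p q i j where pq: "p \<in> {1..4}" "q \<in> {1..4}"
      and ij: "i \<in> {0..int (g_top p)}" "j \<in> {0..int (g_top q)}"
      and v: "v = fvec p i" and w: "w = fvec q j" by blast
    show ?thesis
    proof (cases "p \<le> q")
      case True
      then show ?thesis unfolding v w by (intro le u pq ij)
    next
      case False
      then have "jacobiator u w v = 0" unfolding v w by (intro le u pq ij) auto
      then show ?thesis using jacobiator_swap[of v u w] jacobiator_cycle by (metis neg_0_equal_iff_equal)
    qed
  qed
  have GGG: "jacobiator u v w = 0" if "u \<in> ?G" "v \<in> ?G" "w \<in> ?G" for u v w
    using that jacobiator_nilradical[OF g(1,4)] by blast
  have "evec n \<in> ?S \<union> ?G" if "n \<in> {1..25}" for n
  proof (cases "n \<in> {4..25}")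
    case True
    then obtain p i where "p \<in> {1..4}" "i \<in> {0..int (g_top p)}" "n = g_first p + nat i"
      by (rule g_index_cases)
    then show ?thesis using evec_eq_fvec by blast
  next
    case False
    then have "n = 1 \<or> n = 2 \<or> n = 3" using that by auto
    then show ?thesis by blast
  qed
  then have "evec k \<in> ?S \<union> ?G" "evec l \<in> ?S \<union> ?G" "evec n \<in> ?S \<union> ?G"
    using kln by blast+
  with jacobiator_sl2_sl2_sl2 SSG SGG GGG show "jacobiator (evec k) (evec l) (evec n) = 0"
    by (rule jacobiator_eq_0_on_Un)
qed

end

section \<open>The table\<close>

definition table_bracket :: "complex \<Rightarrow> complex \<Rightarrow> complex \<Rightarrow> complex \<Rightarrow> nat \<Rightarrow> nat \<Rightarrow> complex ^ 25" where
  "table_bracket a b c d i j =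
     (case map_of (L_table a b c d) (i, j) of None \<Rightarrow> 0 | Some (s, k) \<Rightarrow> s *s evec k)"

lemma atLeastAtMost_0_6: "{0..6 :: int} = {0, 1, 2, 3, 4, 5, 6}"
  and atLeastAtMost_0_4: "{0..4 :: int} = {0, 1, 2, 3, 4}"
  by auto

lemmas table_simps = table_bracket_def L_table_def transvectant_def fvec_def g_first_def g_top_def
  transvectant_coeff_numeral vector_smult_assoc

text \<open>For i = 0 the coefficient of order s is m(m - 1)...(m - s + 1) j(j - 1)...(j - s + 1).
  At the normalised entries, where j = s, it is 720, 8640, 144 and 86400, and 3a/720 = a/240; b/144,
  c/72 and d/5760 arise likewise below. Some absent pairs, such as f_1, f_4 in g_1, are allowed by
  weight but have coefficient zero.\<close>

lemma table_bracket_11: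
  assumes "i \<in> {0..6}" "j \<in> {0..6}" "i < j"
  shows "table_bracket a b c d (4 + nat i) (4 + nat j) = (a / 240) *s transvectant 1 1 3 3 i j"
  using assms unfolding atLeastAtMost_0_6 by (elim insertE emptyE) (simp_all add: table_simps)

lemma table_bracket_12:
  assumes "i \<in> {0..6}" "j \<in> {0..4}"
  shows "table_bracket a b c d (4 + nat i) (11 + nat j) = (b / 144) *s transvectant 1 2 4 4 i j"
  using assms unfolding atLeastAtMost_0_6 atLeastAtMost_0_4
  by (elim insertE emptyE) (simp_all add: table_simps)

lemma table_bracket_22:
  assumes "i \<in> {0..4}" "j \<in> {0..4}" "i < j"
  shows "table_bracket a b c d (11 + nat i) (11 + nat j) = (c / 72) *s transvectant 2 2 4 3 i j"
  using assms unfolding atLeastAtMost_0_4 by (elim insertE emptyE) (simp_all add: table_simps)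

lemma table_bracket_13:
  assumes "i \<in> {0..6}" "j \<in> {0..6}"
  shows "table_bracket a b c d (4 + nat i) (16 + nat j) = (d / 5760) *s transvectant 1 3 4 5 i j"
  using assms unfolding atLeastAtMost_0_6 by (elim insertE emptyE) (simp_all add: table_simps)

lemma table_bracket_eq_0:
  assumes "i \<ge> 11 \<and> j \<ge> 16 \<or> j \<ge> 23"
  shows "table_bracket a b c d i j = 0"
proof -
  have "map_of (L_table a b c d) (i, j) = None"
    unfolding map_of_eq_None_iff using assms by (auto simp: L_table_def)
  then show ?thesis by (simp add: table_bracket_def)
qed

lemma brackets_as_listed_iff:
  "brackets_as_listed a b c d br \<longleftrightarrow>
     (\<forall>p\<in>{1..4}. \<forall>q\<in>{1..4}. \<forall>i\<in>{0..int (g_top p)}. \<forall>j\<in>{0..int (g_top q)}.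
        g_first p + nat i < g_first q + nat j \<longrightarrow>
        br (fvec p i) (fvec q j) = table_bracket a b c d (g_first p + nat i) (g_first q + nat j))"
  (is "?L \<longleftrightarrow> ?R")
proof
  assume L: ?L
  show ?R
  proof (intro ballI impI)
    fix p q :: nat and i j :: int
    assume "p \<in> {1..4}" "q \<in> {1..4}" and ij: "i \<in> {0..int (g_top p)}" "j \<in> {0..int (g_top q)}"
      and less: "g_first p + nat i < g_first q + nat j"
    then have "4 \<le> g_first p + nat i" "g_first q + nat j \<le> 25"
      by (auto simp: g_first_def g_top_def split: if_splits)
    with L less show "br (fvec p i) (fvec q j) = table_bracket a b c d (g_first p + nat i) (g_first q + nat j)"
      unfolding brackets_as_listed_def table_bracket_def evec_eq_fvec[OF ij(1), symmetric]
        evec_eq_fvec[OF ij(2), symmetric] by blast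
  qed
next
  assume R: ?R
  show ?L
    unfolding brackets_as_listed_def table_bracket_def[symmetric]
  proof (intro allI impI)
    fix m n :: nat assume mn: "4 \<le> m \<and> m < n \<and> n \<le> 25"
    obtain p i where p: "p \<in> {1..4}" "i \<in> {0..int (g_top p)}" "m = g_first p + nat i"
      using mn by (auto intro: g_index_cases[of m])
    obtain q j where q: "q \<in> {1..4}" "j \<in> {0..int (g_top q)}" "n = g_first q + nat j"
      using mn by (auto intro: g_index_cases[of n])
    show "br (evec m) (evec n) = table_bracket a b c d m n"
      using R p q mn by (simp add: evec_eq_fvec)
  qed
qed

section \<open>Table entries as transvectants\<close>

context graded_product
begin

text \<open>The table lists only pairs with i < j. An odd transvectant is antisymmetric, as is the
  bracket, so these pairs determine the rest; on the diagonal the coefficient equals its own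
  negative.\<close>

lemma given_by_transvectant_odd:
  assumes less: "\<And>i j. i \<in> {0..int (g_top p)} \<Longrightarrow> j \<in> {0..int (g_top p)} \<Longrightarrow> i < j \<Longrightarrow>
      br (fvec p i) (fvec p j) = z *s transvectant p p r s i j"
    and "odd s"
  shows "given_by_transvectant p p r s z"
  unfolding given_by_transvectant_def
proof (intro ballI)
  fix i j assume ij: "i \<in> {0..int (g_top p)}" "j \<in> {0..int (g_top p)}"
  have swap: "transvectant p p r s j i = - transvectant p p r s i j" for i j
    unfolding transvectant_def transvectant_coeff_swap[of s "int (g_top p) - j" j]
    using \<open>odd s\<close> by (simp add: add.commute)
  show "br (fvec p i) (fvec p j) = z *s transvectant p p r s i j"
  proof (cases i j rule: linorder_cases)
    case less
    then show ?thesis using assms(1) ij by blast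
  next
    case equal
    have "transvectant_coeff s (int (g_top p) - i) i (int (g_top p) - i) i = 0"
      using transvectant_coeff_swap[of s "int (g_top p) - i" i "int (g_top p) - i" i] \<open>odd s\<close> by simp
    then show ?thesis using equal by (simp add: self transvectant_def)
  next
    case greater
    then show ?thesis
      using assms(1)[of j i] ij anticommute[of "fvec p i" "fvec p j"] swap[of j i] by simp
  qed
qed

lemma listed_imp_given_by_transvectant:
  assumes listed: "brackets_as_listed a b c d br"
  shows "given_by_transvectant 1 1 3 3 (a / 240)" "given_by_transvectant 1 2 4 4 (b / 144)"
    "given_by_transvectant 2 2 4 3 (c / 72)" "given_by_transvectant 1 3 4 5 (d / 5760)"
proof -
  note entry = listed[unfolded brackets_as_listed_iff, rule_format]
  show "given_by_transvectant 1 1 3 3 (a / 240)"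
  proof (rule given_by_transvectant_odd)
    fix i j assume "i \<in> {0..int (g_top 1)}" "j \<in> {0..int (g_top 1)}" "i < j"
    then show "br (fvec 1 i) (fvec 1 j) = (a / 240) *s transvectant 1 1 3 3 i j"
      using entry[of 1 1 i j] table_bracket_11[of i j a b c d] by (simp add: g_first_def g_top_def)
  qed simp
  show "given_by_transvectant 2 2 4 3 (c / 72)"
  proof (rule given_by_transvectant_odd)
    fix i j assume "i \<in> {0..int (g_top 2)}" "j \<in> {0..int (g_top 2)}" "i < j"
    then show "br (fvec 2 i) (fvec 2 j) = (c / 72) *s transvectant 2 2 4 3 i j"
      using entry[of 2 2 i j] table_bracket_22[of i j a b c d] by (simp add: g_first_def g_top_def)
  qed simp
  show "given_by_transvectant 1 2 4 4 (b / 144)"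
    unfolding given_by_transvectant_def
  proof (intro ballI)
    fix i j assume "i \<in> {0..int (g_top 1)}" "j \<in> {0..int (g_top 2)}"
    then show "br (fvec 1 i) (fvec 2 j) = (b / 144) *s transvectant 1 2 4 4 i j"
      using entry[of 1 2 i j] table_bracket_12[of i j a b c d]
      by (simp add: g_first_def g_top_def nat_less_iff)
  qed
  show "given_by_transvectant 1 3 4 5 (d / 5760)"
    unfolding given_by_transvectant_def
  proof (intro ballI)
    fix i j assume "i \<in> {0..int (g_top 1)}" "j \<in> {0..int (g_top 3)}"
    then show "br (fvec 1 i) (fvec 3 j) = (d / 5760) *s transvectant 1 3 4 5 i j"
      using entry[of 1 3 i j] table_bracket_13[of i j a b c d]
      by (simp add: g_first_def g_top_def nat_less_iff)
  qed
qed

lemma given_by_transvectant_imp_listed: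
  assumes g: "given_by_transvectant 1 1 3 3 (a / 240)" "given_by_transvectant 1 2 4 4 (b / 144)"
    "given_by_transvectant 2 2 4 3 (c / 72)" "given_by_transvectant 1 3 4 5 (d / 5760)"
  shows "brackets_as_listed a b c d br"
  unfolding brackets_as_listed_iff
proof (intro ballI impI)
  fix p q :: nat and i j :: int
  assume pq: "p \<in> {1..4}" "q \<in> {1..4}"
    and ij: "i \<in> {0..int (g_top p)}" "j \<in> {0..int (g_top q)}"
    and less: "g_first p + nat i < g_first q + nat j"
  have "p \<le> q"
    using pq ij less by (cases rule: g_cases[OF pq(1)]; cases rule: g_cases[OF pq(2)])
      (auto simp: g_first_def g_top_def)
  then consider "p = 1" "q = 1" | "p = 1" "q = 2" | "p = 2" "q = 2" | "p = 1" "q = 3" |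
      "(p, q) \<notin> {(1, 1), (1, 2), (2, 1), (2, 2), (1, 3), (3, 1)}"
    by auto
  then show "br (fvec p i) (fvec q j) =
      table_bracket a b c d (g_first p + nat i) (g_first q + nat j)"
  proof cases
    case 1 then show ?thesis
      using g(1) ij less table_bracket_11[of i j a b c d]
      by (simp add: given_by_transvectant_def g_first_def g_top_def)
  next
    case 2 then show ?thesis
      using g(2) ij less table_bracket_12[of i j a b c d]
      by (simp add: given_by_transvectant_def g_first_def g_top_def)
  next
    case 3 then show ?thesis
      using g(3) ij less table_bracket_22[of i j a b c d]
      by (simp add: given_by_transvectant_def g_first_def g_top_def)
  next
    case 4 then show ?thesis
      using g(4) ij less table_bracket_13[of i j a b c d]
      by (simp add: given_by_transvectant_def g_first_def g_top_def)
  next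
    case 5
    \<comment> \<open>The remaining pairs with p <= q have p >= 2 and q >= 3, or q = 4, and the
      table contains no entry for them.\<close>
    then have "g_first p \<ge> 11 \<and> g_first q \<ge> 16 \<or> g_first q \<ge> 23"
      using pq \<open>p \<le> q\<close> by (auto simp: g_first_def split: if_splits)
    then have "table_bracket a b c d (g_first p + nat i) (g_first q + nat j) = 0"
      by (intro table_bracket_eq_0) auto
    then show ?thesis using bracket_shape(3)[OF fvec_in_gsub fvec_in_gsub pq 5] by simp
  qed
qed

end

theorem proposition4p1:
  fixes a b c d :: complex
    and br :: "complex ^ 25 \<Rightarrow> complex ^ 25 \<Rightarrow> complex ^ 25"
  assumes "a \<noteq> 0" "b \<noteq> 0" "c \<noteq> 0" "d \<noteq> 0"
    and "considered_product br"
    and "normalised a b c d br"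
  shows "jacobi br \<longleftrightarrow> brackets_as_listed a b c d br"
proof -
  interpret graded_product br by unfold_locales fact
  note fvec_simps = fvec_def g_first_def g_top_def transvectant_coeff_numeral
  have norm: "coord 16 (br (evec 4) (evec 7)) = 3 * a" "coord 23 (br (evec 4) (evec 15)) = 60 * b"
    "coord 23 (br (evec 11) (evec 14)) = 2 * c" "coord 23 (br (evec 4) (evec 21)) = 15 * d"
    using assms(6) by (simp_all add: normalised_def)
  have shape:
    "\<And>x y. x \<in> gsub 1 \<Longrightarrow> y \<in> gsub 1 \<Longrightarrow> br x y \<in> gsub 3"
    "\<And>x y. x \<in> gsub 1 \<Longrightarrow> y \<in> gsub 2 \<Longrightarrow> br x y \<in> gsub 4"
    "\<And>x y. x \<in> gsub 2 \<Longrightarrow> y \<in> gsub 2 \<Longrightarrow> br x y \<in> gsub 4"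
    "\<And>x y. x \<in> gsub 1 \<Longrightarrow> y \<in> gsub 3 \<Longrightarrow> br x y \<in> gsub 4"
    using assms(5) by (simp_all add: considered_product_def nilradical_shape_def)
  show ?thesis
  proof
    assume jac: "jacobi br"
    \<comment> \<open>Each normalisation prescribes the coefficient of the first target basis vector
      in [f_0, f_s], with s = 3, 4, 3, 5 the order of the transvectant, as
      \<open>jacobi_imp_given_by_transvectant\<close> requires.\<close>
    have "given_by_transvectant 1 1 3 3 (a / 240)"
      by (rule jacobi_imp_given_by_transvectant[OF jac])
        (use norm in \<open>simp_all add: shape fvec_simps\<close>)
    moreover have "given_by_transvectant 1 2 4 4 (b / 144)"
      by (rule jacobi_imp_given_by_transvectant[OF jac])
        (use norm in \<open>simp_all add: shape fvec_simps\<close>)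
    moreover have "given_by_transvectant 2 2 4 3 (c / 72)"
      by (rule jacobi_imp_given_by_transvectant[OF jac])
        (use norm in \<open>simp_all add: shape fvec_simps\<close>)
    moreover have "given_by_transvectant 1 3 4 5 (d / 5760)"
      by (rule jacobi_imp_given_by_transvectant[OF jac])
        (use norm in \<open>simp_all add: shape fvec_simps\<close>)
    ultimately show "brackets_as_listed a b c d br"
      by (rule given_by_transvectant_imp_listed)
  next
    assume listed: "brackets_as_listed a b c d br"
    show "jacobi br"
      by (rule given_by_transvectant_imp_jacobi[OF listed_imp_given_by_transvectant[OF listed]])
  qed
qed

end
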